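(* Let $f:[0,\infty)\times\mathbb{R}\to\mathbb{R}$ be locally Lipschitz, and consider a completely positive discretization $\mathcal{D}_\tau^\alpha$ with kernel $C=(c_{n-j}^n)$ on a grid $0=t_0<t_1<t_2<\cdots$. Let $(y_n)_{n\ge0}$ and $(z_n)_{n\ge0}$ be real sequences with $y_0\ge z_0$ and $$\mathcal{D}_\tau^\alpha y_n\ge f(t_n,y_n),\qquad \mathcal{D}_\tau^\alpha z_n\le f(t_n,z_n),\qquad \forall n\ge1 .$$ Then the following comparison principle holds. (1) If $f(t,\cdot)$ is nonincreasing for all $t$, then $y_n\ge z_n$ for all $n$. If $C$ has positive entries, then $y_0>z_0$ implies $y_n>z_n$ for all $n$. (2) Suppose $f(t,\cdot)$ is uniformly Lipschitz with $|\partial_uf(t,u)|\le M$ for all $t,u$, and the discretization satisfies the stability condition $M/c_0^n<1$ for all $n\ge1$. Then $y_n\ge z_n$ for all $n$. If $C$ has positive entries, then $y_0>z_0$ implies $y_n>z_n$ for all $n$.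
   Context: A kernel is a lower triangular real array $C=(c_{n-j}^n)_{1\le j\le n}$, where $c_{n-j}^n$ is the entry in row $n$ and column $j$; "positive entries" means $c_{n-j}^n>0$ for all $1\le j\le n$. The associated discrete fractional derivative (of order $\alpha\in(0,1)$) of a real sequence $(u_n)_{n\ge 0}$ is $$\mathcal{D}_\tau^\alpha u_n:=\sum_{j=1}^n c_{n-j}^n\,(u_j-u_{j-1}),\qquad n\ge1 .$$ Put $b_0^n=c_0^n$ and $b_{n-j}^n=c_{n-j}^n-c_{n-j-1}^n$ for $1\le j\le n-1$. The discretization is called completely positive if for all $n\ge1$: $b_0^n>0$, $b_{n-j}^n\le 0$ for all $1\le j<n$, and $\sum_{j=1}^n b_{n-j}^n\ge 0$. *)

theory Defs
  imports "HOL-Analysis.Analysis"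
begin

text \<open>The library's \<^const>\<open>local_lipschitz\<close> only asks for Lipschitz continuity in the second argument
  of a parametrised family; here the function is locally Lipschitz jointly on its whole domain.\<close>

definition locally_lipschitz_on ::
    "'a::metric_space set \<Rightarrow> ('a \<Rightarrow> 'b::metric_space) \<Rightarrow> bool" where
  "locally_lipschitz_on S f \<longleftrightarrow> (\<forall>x\<in>S. \<exists>r>0. \<exists>L. L-lipschitz_on (cball x r \<inter> S) f)"

text \<open>\<open>c n k\<close> is the entry $c^n_k$ with upper index \<open>n\<close>: row \<open>n\<close>, column \<open>j\<close> holds \<open>c n (n - j)\<close>.
  Only \<open>n \<ge> 1\<close> and \<open>k < n\<close> are entries of the triangular array; other values are never used.\<close>

type_synonym kernel = "nat \<Rightarrow> nat \<Rightarrow> real"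

definition positive_entries :: "kernel \<Rightarrow> bool" where
  "positive_entries c \<longleftrightarrow> (\<forall>n\<ge>1. \<forall>j\<in>{1..n}. c n (n - j) > 0)"

definition discrete_deriv :: "kernel \<Rightarrow> (nat \<Rightarrow> real) \<Rightarrow> nat \<Rightarrow> real" where
  "discrete_deriv c u n = (\<Sum>j=1..n. c n (n - j) * (u j - u (j - 1)))"

definition kernel_diff :: "kernel \<Rightarrow> nat \<Rightarrow> nat \<Rightarrow> real" where
  "kernel_diff c n k = (if k = 0 then c n 0 else c n k - c n (k - 1))"

definition completely_positive :: "kernel \<Rightarrow> bool" where
  "completely_positive c \<longleftrightarrow>
     (\<forall>n\<ge>1. kernel_diff c n 0 > 0 \<and>
            (\<forall>j. 1 \<le> j \<and> j < n \<longrightarrow> kernel_diff c n (n - j) \<le> 0) \<and>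
            (\<Sum>j=1..n. kernel_diff c n (n - j)) \<ge> 0)"

text \<open>Lipschitz in the second argument, uniformly in \<open>t \<ge> 0\<close>, with partial derivative bounded by \<open>M\<close>.
  A Lipschitz function need not be differentiable everywhere, only almost everywhere, so the
  partial derivative and its bound are required at almost every \<open>u\<close>.\<close>

definition uniformly_lipschitz_deriv_bound :: "real \<Rightarrow> (real \<Rightarrow> real \<Rightarrow> real) \<Rightarrow> bool" where
  "uniformly_lipschitz_deriv_bound M f \<longleftrightarrow>
     (\<exists>L. \<forall>t\<ge>0. L-lipschitz_on UNIV (f t)) \<and>
     (\<forall>t\<ge>0. AE u in lborel. f t differentiable (at u) \<and> \<bar>deriv (f t) u\<bar> \<le> M)"

end

theory Submission
  imports Defs
begin

text \<open>
  Summation by parts rewrites the discrete derivative as \<open>c n 0 * u n\<close> plus a combination of the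
  earlier values whose coefficients are nonpositive by complete positivity. Hence \<open>w = y - z\<close>
  satisfies \<open>c n 0 * w n - (f (t n) (y n) - f (t n) (z n)) \<ge> 0\<close> as soon as the earlier \<open>w j\<close> are
  nonnegative, and a negative \<open>w n\<close> contradicts the one-sided bound
  \<open>f (t n) v - f (t n) u \<le> K * (v - u)\<close> for \<open>u \<le> v\<close> with \<open>K < c n 0\<close>. Both parts are instances:
  \<open>K = 0\<close> for nonincreasing \<open>f\<close>, and \<open>K = M\<close> under the derivative bound.
\<close>

text \<open>A Lipschitz map sends null sets to null sets, so if \<open>g a < g b\<close>, some level
  strictly between them is attained only where the derivative exists and is negative. This stands in
  for the mean value theorem, which would ask for a derivative at every interior point.\<close>

lemma lipschitz_AE_deriv_neg_imp_le:
  fixes g :: "real \<Rightarrow> real"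
  assumes lip: "L-lipschitz_on UNIV g"
    and deriv: "AE x in lborel. \<exists>D<0. (g has_real_derivative D) (at x)"
    and "a \<le> b"
  shows "g b \<le> g a"
proof (rule ccontr)
  assume "\<not> g b \<le> g a"
  define N where "N = {x. \<not> (\<exists>D<0. (g has_real_derivative D) (at x))}"
  have "AE x in lebesgue. \<exists>D<0. (g has_real_derivative D) (at x)"
    using deriv by (rule AE_completion)
  then have "negligible N"
    by (auto simp: N_def eventually_ae_filter_negligible intro: negligible_subset)
  then have "negligible (g ` N)"
  proof (rule negligible_locally_Lipschitz_image[rotated])
    show "\<exists>T B. open T \<and> x \<in> T \<and> (\<forall>y\<in>N \<inter> T. norm (g y - g x) \<le> B * norm (y - x))" for x
      using lipschitz_onD[OF lip] by (intro exI[of _ UNIV] exI[of _ L]) (auto simp: dist_norm)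
  qed simp
  moreover have "\<not> negligible {g a<..<g b}"
    using \<open>\<not> g b \<le> g a\<close> negligible_interval(2)[of "g a" "g b"] by (simp add: box_real)
  \<comment> \<open>The last point at which \<open>g\<close> takes a value outside the null set \<open>g ` N\<close> has a
    negative derivative, yet \<open>g\<close> stays above that value to its right.\<close>
  ultimately obtain v where v: "g a < v" "v < g b" "v \<notin> g ` N"
    by (metis greaterThanLessThan_iff negligible_subset subsetI)
  have cont: "continuous_on S g" for S
    using lipschitz_on_continuous_on[OF lip] continuous_on_subset by blast
  define S where "S = {a..b} \<inter> {x. g x \<le> v}"
  have "closed {x. g x \<le> v}"
    by (intro closed_Collect_le cont continuous_on_const)
  then have "compact S"
    unfolding S_def by (intro compact_Int_closed compact_Icc)
  moreover have "a \<in> S"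
    using \<open>a \<le> b\<close> v by (auto simp: S_def)
  ultimately obtain x where x: "x \<in> S" "\<And>s. s \<in> S \<Longrightarrow> s \<le> x"
    using compact_attains_sup[of S] by blast
  have "x < b"
    using x(1) v by (cases "x = b") (auto simp: S_def)
  have above: "g s > v" if "x < s" "s \<le> b" for s
    using x(2)[of s] x(1) that by (force simp: S_def)
  have "g x = v"
  proof (rule ccontr)
    assume "g x \<noteq> v"
    obtain s where s: "x \<le> s" "s \<le> b" "g s = v"
      using IVT'[of g x v b] x(1) v \<open>x < b\<close> cont by (force simp: S_def)
    then show False
      using above[of s] \<open>g x \<noteq> v\<close> by (cases "s = x") auto
  qed
  with v obtain D where "D < 0" "(g has_real_derivative D) (at x)"
    by (force simp: N_def)
  then obtain d where d: "d > 0" "\<And>h. 0 < h \<Longrightarrow> h < d \<Longrightarrow> g (x + h) < g x"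
    using DERIV_neg_dec_right by blast
  define h where "h = min (d / 2) (b - x)"
  have "0 < h" "h < d" "x + h \<le> b"
    using d \<open>x < b\<close> by (auto simp: h_def min_def)
  then show False
    using d(2)[of h] above[of "x + h"] \<open>g x = v\<close> by simp
qed

text \<open>Subtracting a line of slope \<open>k\<close> slightly above \<open>M\<close> makes the
  derivative negative almost everywhere; the excess slope then tends to \<open>M\<close>.\<close>

lemma lipschitz_AE_deriv_le_imp_diff_le:
  fixes g :: "real \<Rightarrow> real"
  assumes lip: "L-lipschitz_on UNIV g"
    and deriv: "AE x in lborel. g differentiable (at x) \<and> deriv g x \<le> M"
    and "a \<le> b"
  shows "g b - g a \<le> M * (b - a)"
proof (rule field_le_epsilon)
  fix e :: real
  assume "e > 0"
  \<comment> \<open>The \<open>+ 1\<close> keeps the denominator positive when \<open>a = b\<close>,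
    while the excess \<open>(k - M) * (b - a)\<close> stays at most \<open>e\<close>.\<close>
  define k where "k = M + e / (b - a + 1)"
  have "k > M"
    using \<open>e > 0\<close> \<open>a \<le> b\<close> by (simp add: k_def)
  have "(L + \<bar>k\<bar> * 1)-lipschitz_on UNIV (\<lambda>x. g x - k * x)"
    by (intro lipschitz_on_diff lipschitz_on_cmult_real lip lipschitz_intros)
  moreover have "AE x in lborel. \<exists>D<0. ((\<lambda>x. g x - k * x) has_real_derivative D) (at x)"
    using deriv
  proof eventually_elim
    case (elim x)
    then have "(g has_real_derivative deriv g x) (at x)"
      by (simp add: DERIV_deriv_iff_real_differentiable)
    then have "((\<lambda>x. g x - k * x) has_real_derivative deriv g x - k) (at x)"
      by (auto intro!: derivative_eq_intros)
    with elim \<open>k > M\<close> show ?case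
      by (intro exI[of _ "deriv g x - k"]) simp
  qed
  ultimately have "g b - k * b \<le> g a - k * a"
    using \<open>a \<le> b\<close> by (rule lipschitz_AE_deriv_neg_imp_le)
  moreover have "(k - M) * (b - a) \<le> e"
    using \<open>e > 0\<close> \<open>a \<le> b\<close> by (simp add: k_def field_simps)
  ultimately show "g b - g a \<le> M * (b - a) + e"
    by (simp add: algebra_simps)
qed

lemma discrete_deriv_diff:
  "discrete_deriv c (\<lambda>j. u j - v j) n = discrete_deriv c u n - discrete_deriv c v n"
  by (simp add: discrete_deriv_def algebra_simps flip: sum_subtractf)

text \<open>Abel summation against a reversed row. For a kernel row, the coefficients of the middle
  sum are the values of \<open>kernel_diff\<close> whose sign complete positivity fixes.\<close>

lemma sum_by_parts_reverse:
  fixes a u :: "nat \<Rightarrow> 'a::comm_ring"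
  shows "(\<Sum>j=1..Suc m. a (Suc m - j) * (u j - u (j - 1))) =
    a 0 * u (Suc m) + (\<Sum>j=1..m. (a (Suc m - j) - a (m - j)) * u j) - a m * u 0"
proof -
  have "(\<Sum>j=1..Suc m. a (Suc m - j) * (u j - u (j - 1))) =
      (\<Sum>j=1..Suc m. a (Suc m - j) * u j) - (\<Sum>j=1..Suc m. a (Suc m - j) * u (j - 1))"
    by (simp only: right_diff_distrib sum_subtractf)
  also have "(\<Sum>j=1..Suc m. a (Suc m - j) * u (j - 1)) = (\<Sum>j=0..m. a (m - j) * u j)"
    by (rule sum.reindex_bij_witness[of _ Suc "\<lambda>j. j - 1"]) auto
  also have "\<dots> = a m * u 0 + (\<Sum>j=1..m. a (m - j) * u j)"
    by (simp add: sum.atLeast_Suc_atMost)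
  finally show ?thesis
    by (simp add: left_diff_distrib sum_subtractf algebra_simps)
qed

text \<open>The sum telescopes. For \<open>n = Suc m\<close> it turns the last condition of complete
  positivity into nonnegativity of the first-column entry.\<close>

lemma sum_kernel_diff:
  "(\<Sum>j=1..Suc m. kernel_diff c n (Suc m - j)) = c n m"
proof -
  have "(\<Sum>j=1..Suc m. kernel_diff c n (Suc m - j)) = (\<Sum>k\<le>m. kernel_diff c n k)"
    by (rule sum.reindex_bij_witness[of _ "\<lambda>k. Suc m - k" "\<lambda>j. Suc m - j"]) auto
  also have "\<dots> = c n m"
    by (induction m) (auto simp: kernel_diff_def)
  finally show ?thesis .
qed

text \<open>The middle terms of the summation by parts are nonpositive and are dropped. The term in
  \<open>w 0\<close> is kept, since strict comparison rests on it.\<close>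

lemma discrete_deriv_le:
  assumes cp: "completely_positive c"
    and nonneg: "\<And>j. j \<le> m \<Longrightarrow> w j \<ge> 0"
  shows "discrete_deriv c w (Suc m) \<le> c (Suc m) 0 * w (Suc m) - c (Suc m) m * w 0"
proof -
  have "kernel_diff c (Suc m) (Suc m - j) \<le> 0" if "j \<in> {1..m}" for j
    using cp that by (simp add: completely_positive_def)
  then have "c (Suc m) (Suc m - j) - c (Suc m) (m - j) \<le> 0" if "j \<in> {1..m}" for j
    using that by (force simp: kernel_diff_def)
  then have "(\<Sum>j=1..m. (c (Suc m) (Suc m - j) - c (Suc m) (m - j)) * w j) \<le> 0"
    using nonneg by (intro sum_nonpos mult_nonpos_nonneg) auto
  then show ?thesis
    unfolding discrete_deriv_def sum_by_parts_reverse by simp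
qed

lemma comparison_principle:
  fixes y z :: "nat \<Rightarrow> real" and F :: "nat \<Rightarrow> real \<Rightarrow> real"
  assumes cp: "completely_positive c"
    and init: "y 0 \<ge> z 0"
    and super: "\<And>n. n \<ge> 1 \<Longrightarrow> discrete_deriv c y n \<ge> F n (y n)"
    and sub: "\<And>n. n \<ge> 1 \<Longrightarrow> discrete_deriv c z n \<le> F n (z n)"
    and F: "\<And>n u v. n \<ge> 1 \<Longrightarrow> u \<le> v \<Longrightarrow> F n v - F n u \<le> K * (v - u)"
    and K: "\<And>n. n \<ge> 1 \<Longrightarrow> K < c n 0"
  shows "y n \<ge> z n" and "positive_entries c \<Longrightarrow> y 0 > z 0 \<Longrightarrow> y n > z n"
proof -
  have step: "c (Suc m) 0 * (y (Suc m) - z (Suc m)) - (F (Suc m) (y (Suc m)) - F (Suc m) (z (Suc m)))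
      \<ge> c (Suc m) m * (y 0 - z 0)" if "\<And>j. j \<le> m \<Longrightarrow> y j \<ge> z j" for m
    using discrete_deriv_le[OF cp, of m "\<lambda>j. y j - z j"] that super[of "Suc m"] sub[of "Suc m"]
    by (simp add: discrete_deriv_diff)
  \<comment> \<open>The coefficient of the initial gap \<open>y 0 - z 0\<close> is a full row sum of
    \<open>kernel_diff\<close>.\<close>
  have last_nonneg: "c (Suc m) m \<ge> 0" for m
    using cp sum_kernel_diff[of c "Suc m" m] unfolding completely_positive_def
    by (metis le_add1 plus_1_eq_Suc)
  show ge: "y n \<ge> z n" for n
  proof (induction n rule: less_induct)
    case (less n)
    show ?case
    proof (cases n)
      case 0
      with init show ?thesis by simp
    next
      case (Suc m)
      show ?thesis
      proof (rule ccontr)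
        assume "\<not> y n \<ge> z n"
        then have neg: "y n < z n" by simp
        have "0 \<le> c n m * (y 0 - z 0)"
          using init last_nonneg[of m] Suc by simp
        also have "\<dots> \<le> c n 0 * (y n - z n) - (F n (y n) - F n (z n))"
          using step[of m] less Suc by simp
        \<comment> \<open>As \<open>y n < z n\<close>, the one-sided bound runs from
          \<open>y n\<close> up to \<open>z n\<close>.\<close>
        also have "\<dots> \<le> (c n 0 - K) * (y n - z n)"
          using F[of n "y n" "z n"] neg Suc by (simp add: algebra_simps)
        also have "\<dots> < 0"
          using K[of n] neg Suc by (simp add: mult_pos_neg)
        finally show False by simp
      qed
    qed
  qed
  assume pos: "positive_entries c" and strict: "y 0 > z 0"
  show "y n > z n"
  proof (cases n)
    case 0
    with strict show ?thesis by simp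
  next
    case (Suc m)
    have "c (Suc m) (Suc m - 1) > 0"
      using pos unfolding positive_entries_def by (metis One_nat_def atLeastAtMost_iff le_add1 order_refl plus_1_eq_Suc)
    then have "c n m * (y 0 - z 0) > 0"
      using strict Suc by simp
    \<comment> \<open>If the two values agreed, the \<open>F\<close> terms would cancel and the left
      side of \<open>step\<close> would be 0, although it dominates a positive multiple of the
      initial gap.\<close>
    then have "y n \<noteq> z n"
      using step[of m] ge Suc by auto
    with ge[of n] show ?thesis by simp
  qed
qed

theorem theorem3p2:
  fixes f :: "real \<Rightarrow> real \<Rightarrow> real" and c :: kernel
    and t y z :: "nat \<Rightarrow> real"
  assumes "locally_lipschitz_on ({0..} \<times> UNIV) (\<lambda>(s, u). f s u)"
    and "completely_positive c"
    and "t 0 = 0" and "strict_mono t"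
    and "y 0 \<ge> z 0"
    and "\<And>n. n \<ge> 1 \<Longrightarrow> discrete_deriv c y n \<ge> f (t n) (y n)"
    and "\<And>n. n \<ge> 1 \<Longrightarrow> discrete_deriv c z n \<le> f (t n) (z n)"
  shows "((\<forall>s\<ge>0. antimono (f s)) \<longrightarrow>
           (\<forall>n. y n \<ge> z n) \<and>
           (positive_entries c \<longrightarrow> y 0 > z 0 \<longrightarrow> (\<forall>n. y n > z n)))
       \<and> (\<forall>M. uniformly_lipschitz_deriv_bound M f \<and> (\<forall>n\<ge>1. M / c n 0 < 1) \<longrightarrow>
           (\<forall>n. y n \<ge> z n) \<and>
           (positive_entries c \<longrightarrow> y 0 > z 0 \<longrightarrow> (\<forall>n. y n > z n)))"
proof -
  have t: "t n \<ge> 0" for n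
    using strict_mono_less_eq[OF assms(4), of 0 n] assms(3) by simp
  have c0: "c n 0 > 0" if "n \<ge> 1" for n
    using assms(2) that by (simp add: completely_positive_def kernel_diff_def)
  note comparison = comparison_principle[OF assms(2), where F = "\<lambda>n. f (t n)", OF assms(5-7)]
  show ?thesis
  proof (intro conjI[of "_ \<longrightarrow> _"] allI impI)
    assume anti: "\<forall>s\<ge>0. antimono (f s)"
    have "f (t n) v - f (t n) u \<le> 0 * (v - u)" if "u \<le> v" for n u v
      using antimonoD[OF anti[rule_format, OF t] that] by simp
    then show "(\<forall>n. y n \<ge> z n) \<and> (positive_entries c \<longrightarrow> y 0 > z 0 \<longrightarrow> (\<forall>n. y n > z n))"
      using comparison[of 0] c0 by blast
  next
    fix M
    assume M: "uniformly_lipschitz_deriv_bound M f \<and> (\<forall>n\<ge>1. M / c n 0 < 1)"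
    then obtain L where lip: "\<And>s. s \<ge> 0 \<Longrightarrow> L-lipschitz_on UNIV (f s)"
      and deriv: "\<And>s. s \<ge> 0 \<Longrightarrow>
        AE u in lborel. f s differentiable (at u) \<and> \<bar>deriv (f s) u\<bar> \<le> M"
      unfolding uniformly_lipschitz_deriv_bound_def by blast
    \<comment> \<open>The derivative is controlled only almost everywhere, so the increment bound
      with \<open>K = M\<close> comes from the null-set argument.\<close>
    have "f (t n) v - f (t n) u \<le> M * (v - u)" if "u \<le> v" for n u v
      using lip[OF t] _ that
    proof (rule lipschitz_AE_deriv_le_imp_diff_le)
      show "AE x in lborel. f (t n) differentiable (at x) \<and> deriv (f (t n)) x \<le> M"
        using deriv[OF t[of n]] by eventually_elim auto
    qed
    moreover have "M < c n 0" if "n \<ge> 1" for n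
      using M c0[OF that] that pos_divide_less_eq[of "c n 0" M 1] by auto
    ultimately show "(\<forall>n. y n \<ge> z n) \<and> (positive_entries c \<longrightarrow> y 0 > z 0 \<longrightarrow> (\<forall>n. y n > z n))"
      using comparison[of M] by blast
  qed
qed

end
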